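(* Let $m,n\geq 0$. The Galois graph of $\mathbf{W}(m,n)$ is the directed graph on the set of join-irreducible elements of $\mathbf{W}(m,n)$ in which, for distinct join-irreducibles $\mathfrak{j}\ne\mathfrak{j}'$, there is an arrow $\mathfrak{j}\to\mathfrak{j}'$ if and only if either $\mathfrak{j}=\mathfrak{a}^{(s,t)}$, $\mathfrak{j}'=\mathfrak{a}^{(s',t')}$ with $s\ge s'$ and $t\ge t'$, or $\mathfrak{j}=\mathfrak{b}^{(s)}$, $\mathfrak{j}'=\mathfrak{a}^{(s',t')}$ with $s=s'$.
   Context: An $(m,n)$-word is a word $\mathfrak{w}=w_1w_2\cdots w_n$ of length $n$ over the alphabet $\{0,1,\dots,m+1\}$ such that (MN1) $w_1\neq m+1$, and (MN2) for every $s$ with $1\le s\le m$ and every index $i$, if $w_i=s$ then $w_j\ge s$ for all $j<i$. $\mathbf{W}(m,n)$ is the set of $(m,n)$-words ordered componentwise; it is an extremal, interval-constructable lattice whose join is componentwise maximum. Its join-irreducible elements (elements covering exactly one element) are exactly the words $\mathfrak{a}^{(s,t)}$ ($1\le s\le n$, $1\le t\le m$), having letter $t$ in positions $1,\dots,s$ and $0$ elsewhere, and $\mathfrak{b}^{(s)}$ ($2\le s\le n$), having letter $m+1$ in position $s$ and $0$ elsewhere. For a join-irreducible $j$ let $j_*$ denote the unique element it covers. For an extremal, interval-constructable lattice $\mathbf{P}$, its Galois graph is the directed graph on the join-irreducible elements of $\mathbf{P}$ with an arrow $j\to j'$ if and only if $j\ne j'$ and $j'\le j'_*\vee j$. *)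

theory Defs
  imports "HOL-Algebra.Lattice" "Graph_Theory.Pair_Digraph"
begin

definition covered_by :: "('a, 'b) gorder_scheme \<Rightarrow> 'a \<Rightarrow> 'a \<Rightarrow> bool" where
  "covered_by P x y \<longleftrightarrow>
     x \<in> carrier P \<and> y \<in> carrier P \<and> x \<sqsubset>\<^bsub>P\<^esub> y \<and>
     \<not> (\<exists>z \<in> carrier P. x \<sqsubset>\<^bsub>P\<^esub> z \<and> z \<sqsubset>\<^bsub>P\<^esub> y)"

definition join_irreducible :: "('a, 'b) gorder_scheme \<Rightarrow> 'a \<Rightarrow> bool" where
  "join_irreducible P j \<longleftrightarrow> j \<in> carrier P \<and> (\<exists>!x. covered_by P x j)"

definition lower_cover :: "('a, 'b) gorder_scheme \<Rightarrow> 'a \<Rightarrow> 'a" where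
  "lower_cover P j = (THE x. covered_by P x j)"

(* Meant for extremal, interval-constructable lattices, where this description
   of the Galois graph is available. The formula itself only uses joins. *)
definition galois_graph :: "('a, 'b) gorder_scheme \<Rightarrow> 'a pair_pre_digraph" where
  "galois_graph P =
     \<lparr> pverts = {j. join_irreducible P j},
       parcs = {(j, j'). join_irreducible P j \<and> join_irreducible P j' \<and> j \<noteq> j' \<and>
                         j' \<sqsubseteq>\<^bsub>P\<^esub> (lower_cover P j' \<squnion>\<^bsub>P\<^esub> j)} \<rparr>"

(* A word w_1 ... w_n is a list, so the letter w_i is w ! (i - 1). *)
definition mn_word :: "nat \<Rightarrow> nat \<Rightarrow> nat list \<Rightarrow> bool" where
  "mn_word m n w \<longleftrightarrow>
     length w = n \<and> set w \<subseteq> {0..m+1} \<and>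
     (n \<ge> 1 \<longrightarrow> w ! 0 \<noteq> m + 1) \<and>
     (\<forall>s i. 1 \<le> s \<and> s \<le> m \<and> i < n \<and> w ! i = s \<longrightarrow> (\<forall>j < i. w ! j \<ge> s))"

definition mn_words :: "nat \<Rightarrow> nat \<Rightarrow> nat list gorder" where
  "mn_words m n =
     \<lparr> carrier = {w. mn_word m n w}, eq = (=), le = list_all2 (\<le>) \<rparr>"

definition a_word :: "nat \<Rightarrow> nat \<Rightarrow> nat \<Rightarrow> nat list" where
  "a_word n s t = map (\<lambda>i. if i \<le> s then t else 0) [1..<n+1]"

definition b_word :: "nat \<Rightarrow> nat \<Rightarrow> nat \<Rightarrow> nat list" where
  "b_word m n s = map (\<lambda>i. if i = s then m + 1 else 0) [1..<n+1]"

end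

theory Submission
  imports Defs
begin

text \<open>Every word is the join of the words \<open>a\<^sup>(\<^sup>i\<^sup>,\<^sup>t\<^sup>)\<close> and \<open>b\<^sup>(\<^sup>i\<^sup>)\<close> read off from its nonzero letters, so the
  join-irreducible words are among these. The word covered by \<open>a\<^sup>(\<^sup>s\<^sup>,\<^sup>t\<^sup>)\<close> differs from it only in
  the letter at position \<open>s\<close>, and \<open>b\<^sup>(\<^sup>s\<^sup>)\<close> covers the zero word. As joins are componentwise, whether
  there is an arrow into \<open>a\<^sup>(\<^sup>s\<^sup>,\<^sup>t\<^sup>)\<close> or \<open>b\<^sup>(\<^sup>s\<^sup>)\<close> depends only on the letter at position \<open>s\<close> of the source.\<close>

section \<open>Lower covers in partial orders\<close>

lemma (in partial_order) lower_cover_eqI: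
  assumes "c \<in> carrier L" "j \<in> carrier L" "c \<sqsubset> j"
    and "\<And>x. x \<in> carrier L \<Longrightarrow> x \<sqsubset> j \<Longrightarrow> x \<sqsubseteq> c"
  shows "lower_cover L j = c"
  unfolding lower_cover_def
proof (rule the_equality)
  show "covered_by L c j"
    using assms unfolding covered_by_def lless_eq by (meson le_antisym)
  show "x = c" if "covered_by L x j" for x
    using that assms unfolding covered_by_def lless_eq by blast
qed

text \<open>By finiteness, some element is maximal among those above \<open>x\<close> and strictly
  below \<open>j\<close>. It is covered by \<open>j\<close>, so uniqueness makes it the lower
  cover.\<close>

lemma (in partial_order) le_lower_cover:
  assumes fin: "finite (carrier L)" and j: "join_irreducible L j"
    and x: "x \<in> carrier L" "x \<sqsubset> j"
  shows "x \<sqsubseteq> lower_cover L j"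
proof -
  define A where "A = {z \<in> carrier L. x \<sqsubseteq> z \<and> z \<sqsubset> j}"
  have "\<exists>z\<in>A. \<forall>y\<in>A. y \<noteq> z \<longrightarrow> \<not> z \<sqsubset> y"
  proof (rule Finite_Set.bex_max_element)
    show "finite A" "A \<noteq> {}"
      using fin x by (auto simp: A_def)
    show "asymp_on A (\<sqsubset>)"
      by (rule asymp_onI) (auto simp: A_def elim: lless_antisym[rotated 2])
    show "transp_on A (\<sqsubset>)"
      by (rule transp_onI) (auto simp: A_def intro: lless_trans)
  qed
  then obtain z where z: "z \<in> A" and max: "\<And>y. y \<in> A \<Longrightarrow> y \<noteq> z \<Longrightarrow> \<not> z \<sqsubset> y"
    by blast
  have jL: "j \<in> carrier L" and unique: "\<exists>!y. covered_by L y j"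
    using j by (auto simp: join_irreducible_def)
  have "\<not> (z \<sqsubset> y \<and> y \<sqsubset> j)" if "y \<in> carrier L" for y
  proof
    assume y: "z \<sqsubset> y \<and> y \<sqsubset> j"
    then have "x \<sqsubseteq> y"
      using z x that le_trans[of x z y] by (auto simp: A_def lless_eq)
    then show False
      using max[of y] that y by (auto simp: A_def lless_eq)
  qed
  then have "covered_by L z j"
    using z jL by (auto simp: covered_by_def A_def)
  then have "lower_cover L j = z"
    using unique unfolding lower_cover_def by (metis the1_equality)
  then show ?thesis
    using z by (simp add: A_def)
qed

section \<open>Words, their order and their joins\<close>

text \<open>Letters \<open>0\<close> satisfy the second word condition trivially, so it extends to all letters up to \<open>m\<close>.\<close>

lemma mn_word_iff_nth:
  "mn_word m n w \<longleftrightarrow> length w = n \<and> (\<forall>i<n. w ! i \<le> m + 1) \<and> (0 < n \<longrightarrow> w ! 0 \<noteq> m + 1) \<and>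
    (\<forall>i<n. w ! i \<le> m \<longrightarrow> (\<forall>j<i. w ! i \<le> w ! j))"
proof -
  have "set w \<subseteq> {0..m+1} \<longleftrightarrow> (\<forall>i<length w. w ! i \<le> m + 1)"
    by (auto simp: set_conv_nth)
  moreover have "(\<forall>s i. 1 \<le> s \<and> s \<le> m \<and> i < n \<and> w ! i = s \<longrightarrow> (\<forall>j<i. s \<le> w ! j)) \<longleftrightarrow>
      (\<forall>i<n. w ! i \<le> m \<longrightarrow> (\<forall>j<i. w ! i \<le> w ! j))"
    by (metis One_nat_def Suc_leI bot_nat_0.extremum bot_nat_0.not_eq_extremum)
  ultimately show ?thesis
    unfolding mn_word_def by (auto simp: Suc_le_eq)
qed

lemma carrier_mn_words [simp]: "w \<in> carrier (mn_words m n) \<longleftrightarrow> mn_word m n w"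
  by (simp add: mn_words_def)

lemma le_mn_words [simp]: "v \<sqsubseteq>\<^bsub>mn_words m n\<^esub> w \<longleftrightarrow> list_all2 (\<le>) v w"
  by (simp add: mn_words_def)

lemma mn_words_partial_order: "partial_order (mn_words m n)"
proof
  fix x y z
  show "x .=\<^bsub>mn_words m n\<^esub> y"
    if "x \<sqsubseteq>\<^bsub>mn_words m n\<^esub> y" "y \<sqsubseteq>\<^bsub>mn_words m n\<^esub> x"
    using that by (simp add: mn_words_def list_all2_conv_all_nth list_eq_iff_nth_eq order_antisym)
  show "x \<sqsubseteq>\<^bsub>mn_words m n\<^esub> z"
    if "x \<sqsubseteq>\<^bsub>mn_words m n\<^esub> y" "y \<sqsubseteq>\<^bsub>mn_words m n\<^esub> z"
    using that by (auto elim: list_all2_trans[rotated])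
qed (auto simp: mn_words_def list_all2_same)

lemma finite_mn_words: "finite (carrier (mn_words m n))"
proof (rule finite_subset)
  show "carrier (mn_words m n) \<subseteq> {w. set w \<subseteq> {0..m+1} \<and> length w = n}"
    by (auto simp: mn_words_def mn_word_def)
qed (simp add: finite_lists_length_eq)

text \<open>The componentwise maximum is again a word: if its letter at \<open>i\<close> is at most
  \<open>m\<close>, so are both original letters, and each is bounded by the earlier letters of its
  own word.\<close>

lemma join_mn_words:
  assumes v: "mn_word m n v" and w: "mn_word m n w"
  shows "v \<squnion>\<^bsub>mn_words m n\<^esub> w = map2 max v w"
proof -
  interpret partial_order "mn_words m n"
    by (rule mn_words_partial_order)
  have len: "length v = n" "length w = n"
    using v w by (auto simp: mn_word_iff_nth)
  have word: "mn_word m n (map2 max v w)"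
    using v w by (fastforce simp: mn_word_iff_nth max_def)
  have "least (mn_words m n) (map2 max v w) (Upper (mn_words m n) {v, w})"
    using word v w len
    by (auto simp: least_def Upper_def list_all2_conv_all_nth)
  then show ?thesis
    unfolding join_def sup_def using least_unique by blast
qed

section \<open>Classification of the join-irreducible words\<close>

lemma length_a_word [simp]: "length (a_word n s t) = n"
  by (simp add: a_word_def)

lemma nth_a_word [simp]: "i < n \<Longrightarrow> a_word n s t ! i = (if i < s then t else 0)"
  by (simp add: a_word_def Suc_le_eq del: upt_Suc)

lemma length_b_word [simp]: "length (b_word m n s) = n"
  by (simp add: b_word_def)

lemma nth_b_word [simp]: "i < n \<Longrightarrow> b_word m n s ! i = (if Suc i = s then m + 1 else 0)"
  by (simp add: b_word_def del: upt_Suc)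

lemma mn_word_a_word: "t \<le> m \<Longrightarrow> mn_word m n (a_word n s t)"
  by (auto simp: mn_word_iff_nth)

lemma mn_word_b_word: "2 \<le> s \<Longrightarrow> mn_word m n (b_word m n s)"
  by (auto simp: mn_word_iff_nth)

text \<open>If \<open>w\<close> had neither form, the \<open>a_word\<close> or \<open>b_word\<close>
  read off from each nonzero letter would lie strictly below \<open>w\<close>, hence below its lower
  cover, forcing \<open>w\<close> below its own lower cover. Here \<open>s\<close> is a list index,
  so positions appear as \<open>Suc s\<close>.\<close>

lemma join_irreducible_mn_words_cases:
  assumes "join_irreducible (mn_words m n) w"
  obtains (a) s t where "s < n" "t < m" "w = a_word n (Suc s) (Suc t)"
    | (b) s where "0 < s" "s < n" "w = b_word m n (Suc s)"
proof (rule ccontr)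
  assume no_thesis: "\<not> thesis"
  have not_a: "w \<noteq> a_word n (Suc s) (Suc t)" if "s < n" "t < m" for s t
    using no_thesis a that by blast
  have not_b: "w \<noteq> b_word m n (Suc s)" if "0 < s" "s < n" for s
    using no_thesis b that by blast
  interpret partial_order "mn_words m n"
    by (rule mn_words_partial_order)
  let ?c = "lower_cover (mn_words m n) w"
  have w: "mn_word m n w"
    using assms by (simp add: join_irreducible_def)
  have "covered_by (mn_words m n) ?c w"
    using assms unfolding join_irreducible_def lower_cover_def by (metis theI')
  then have c: "mn_word m n ?c" "?c \<sqsubset>\<^bsub>mn_words m n\<^esub> w"
    by (auto simp: covered_by_def)
  have below: "list_all2 (\<le>) x ?c"
    if "mn_word m n x" "list_all2 (\<le>) x w" "x \<noteq> w" for x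
    using le_lower_cover[OF finite_mn_words assms, of x] that by (simp add: lless_eq)
  have "w ! i \<le> ?c ! i" if i: "i < n" for i
  proof -
    consider "w ! i = 0" | t where "w ! i = Suc t" "t < m" | "w ! i = m + 1"
      using w i by (cases "w ! i") (force simp: mn_word_iff_nth)+
    then show ?thesis
    proof cases
      case (2 t)
      have "mn_word m n (a_word n (Suc i) (Suc t))"
        using 2 by (intro mn_word_a_word) simp
      \<comment> \<open>A letter at most \<open>m\<close> is bounded by all earlier letters, so the
        whole initial block fits under \<open>w\<close>.\<close>
      moreover have "list_all2 (\<le>) (a_word n (Suc i) (Suc t)) w"
        using w i 2 by (auto simp: mn_word_iff_nth list_all2_conv_all_nth less_Suc_eq)
      ultimately have "list_all2 (\<le>) (a_word n (Suc i) (Suc t)) ?c"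
        using below not_a[OF i 2(2)] by metis
      from list_all2_nthD[OF this, of i] show ?thesis
        using i 2 by simp
    next
      case 3
      \<comment> \<open>No word starts with \<open>m + 1\<close>; thus
        \<open>b_word m n (Suc i)\<close> is a legitimate word.\<close>
      then have "0 < i"
        using w i by (metis mn_word_iff_nth neq0_conv)
      moreover have "mn_word m n (b_word m n (Suc i))"
        using \<open>0 < i\<close> by (intro mn_word_b_word) simp
      moreover have "list_all2 (\<le>) (b_word m n (Suc i)) w"
        using w 3 by (auto simp: mn_word_iff_nth list_all2_conv_all_nth)
      ultimately have "list_all2 (\<le>) (b_word m n (Suc i)) ?c"
        using below not_b[OF _ i] by metis
      from list_all2_nthD[OF this, of i] show ?thesis
        using i 3 by simp
    qed simp
  qed
  then have "list_all2 (\<le>) w ?c"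
    using w c by (simp add: mn_word_iff_nth list_all2_conv_all_nth)
  then show False
    using c w le_antisym[of w ?c] by (simp add: lless_eq)
qed

section \<open>Lower covers of the two families\<close>

lemma mn_word_a_word_update:
  assumes "s < n" "t < m"
  shows "mn_word m n ((a_word n (Suc s) (Suc t))[s := t])"
  using assms by (auto simp: mn_word_iff_nth nth_list_update)

lemma lower_cover_a_word:
  assumes s: "s < n" and t: "t < m"
  shows "lower_cover (mn_words m n) (a_word n (Suc s) (Suc t)) = (a_word n (Suc s) (Suc t))[s := t]"
proof -
  interpret partial_order "mn_words m n"
    by (rule mn_words_partial_order)
  let ?a = "a_word n (Suc s) (Suc t)"
  show ?thesis
  proof (rule lower_cover_eqI)
    show "?a[s := t] \<in> carrier (mn_words m n)"
      using mn_word_a_word_update[OF s t] by simp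
    show "?a \<in> carrier (mn_words m n)"
      using t by (simp add: mn_word_a_word)
    have "?a[s := t] ! s \<noteq> ?a ! s"
      using s by simp
    then have "?a[s := t] \<noteq> ?a"
      by metis
    moreover have "list_all2 (\<le>) (?a[s := t]) ?a"
      using s by (auto simp: list_all2_conv_all_nth nth_list_update)
    ultimately show "?a[s := t] \<sqsubset>\<^bsub>mn_words m n\<^esub> ?a"
      by (simp add: lless_eq)
  next
    fix x
    assume "x \<in> carrier (mn_words m n)" "x \<sqsubset>\<^bsub>mn_words m n\<^esub> ?a"
    then have x: "mn_word m n x" "x \<noteq> ?a" and len: "length x = n"
      and le: "\<And>i. i < n \<Longrightarrow> x ! i \<le> (if i < Suc s then Suc t else 0)"
      by (auto simp: lless_eq list_all2_conv_all_nth mn_word_def)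
    \<comment> \<open>Otherwise the last letter of the block is still \<open>Suc t\<close>, which
      forces \<open>Suc t\<close> at every earlier index and makes \<open>x\<close> equal to
      \<open>?a\<close>.\<close>
    have "x ! s \<le> t"
    proof (rule ccontr)
      assume "\<not> x ! s \<le> t"
      with le[OF s] have last: "x ! s = Suc t"
        by simp
      have "x ! i = ?a ! i" if "i < n" for i
      proof (cases "i < s")
        case True
        with x last s t have "Suc t \<le> x ! i"
          by (force simp: mn_word_iff_nth)
        with le[OF that] True that show ?thesis
          by simp
      next
        case False
        with le[OF that] last that show ?thesis
          by (cases "i = s") auto
      qed
      with x len show False
        by (metis length_a_word nth_equalityI)
    qed
    then have "x ! i \<le> ?a[s := t] ! i" if "i < n" for i
      using le[OF that] that s by (auto simp: nth_list_update)
    then have "list_all2 (\<le>) x (?a[s := t])"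
      using len by (simp add: list_all2_conv_all_nth)
    then show "x \<sqsubseteq>\<^bsub>mn_words m n\<^esub> ?a[s := t]"
      by simp
  qed
qed

lemma mn_word_zero: "mn_word m n (replicate n 0)"
  by (simp add: mn_word_iff_nth)

lemma lower_cover_b_word:
  assumes s: "0 < s" "s < n"
  shows "lower_cover (mn_words m n) (b_word m n (Suc s)) = replicate n 0"
proof -
  interpret partial_order "mn_words m n"
    by (rule mn_words_partial_order)
  let ?b = "b_word m n (Suc s)"
  show ?thesis
  proof (rule lower_cover_eqI)
    show "replicate n 0 \<in> carrier (mn_words m n)"
      by (simp add: mn_word_zero)
    show "?b \<in> carrier (mn_words m n)"
      using s by (simp add: mn_word_b_word)
    have "replicate n 0 ! s \<noteq> ?b ! s"
      using s by simp
    then have "replicate n 0 \<noteq> ?b"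
      by metis
    then show "replicate n 0 \<sqsubset>\<^bsub>mn_words m n\<^esub> ?b"
      by (simp add: lless_eq list_all2_conv_all_nth)
  next
    fix x
    assume "x \<in> carrier (mn_words m n)" "x \<sqsubset>\<^bsub>mn_words m n\<^esub> ?b"
    then have x: "mn_word m n x" "x \<noteq> ?b" and len: "length x = n"
      and le: "\<And>i. i < n \<Longrightarrow> x ! i \<le> (if i = s then m + 1 else 0)"
      by (auto simp: lless_eq list_all2_conv_all_nth mn_word_def)
    have "x ! s \<noteq> m + 1"
    proof
      assume last: "x ! s = m + 1"
      have "x ! i = ?b ! i" if "i < n" for i
        using le[OF that] last that by auto
      with x len show False
        by (metis length_b_word nth_equalityI)
    qed
    then have "x ! s \<le> m"
      using le[of s] s by simp
    \<comment> \<open>A letter at most \<open>m\<close> is bounded by the first letter, which is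
      \<open>0\<close> since \<open>x\<close> lies below \<open>?b\<close> and
      \<open>0 < s\<close>.\<close>
    then have "x ! s \<le> x ! 0"
      using x s by (auto simp: mn_word_iff_nth)
    then have "x ! i = 0" if "i < n" for i
      using le[OF that] le[of 0] s by (cases "i = s") auto
    then show "x \<sqsubseteq>\<^bsub>mn_words m n\<^esub> replicate n 0"
      using len by (simp add: list_all2_conv_all_nth)
  qed
qed

section \<open>The arrow condition as a condition on one letter\<close>

text \<open>The lower cover agrees with the word except at index \<open>s\<close>, where it has
  \<open>t\<close> instead of \<open>Suc t\<close>; only there can the comparison fail.\<close>

lemma a_word_le_join_iff:
  assumes w: "mn_word m n w" and st: "s < n" "t < m"
  shows "a_word n (Suc s) (Suc t) \<sqsubseteq>\<^bsub>mn_words m n\<^esub>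
      lower_cover (mn_words m n) (a_word n (Suc s) (Suc t)) \<squnion>\<^bsub>mn_words m n\<^esub> w \<longleftrightarrow> t < w ! s"
proof -
  let ?a = "a_word n (Suc s) (Suc t)"
  have len: "length w = n"
    using w by (simp add: mn_word_def)
  have "list_all2 (\<le>) ?a (map2 max (?a[s := t]) w) \<longleftrightarrow> t < w ! s"
    using len st by (auto simp: list_all2_conv_all_nth nth_list_update le_max_iff_disj)
  then show ?thesis
    by (simp only: lower_cover_a_word[OF st] join_mn_words[OF mn_word_a_word_update[OF st] w]
        le_mn_words)
qed

text \<open>Joining with the zero word leaves \<open>w\<close> unchanged, and the only nonzero
  letter to dominate is \<open>m + 1\<close> at index \<open>s\<close>.\<close>

lemma b_word_le_join_iff:
  assumes w: "mn_word m n w" and s: "0 < s" "s < n"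
  shows "b_word m n (Suc s) \<sqsubseteq>\<^bsub>mn_words m n\<^esub>
      lower_cover (mn_words m n) (b_word m n (Suc s)) \<squnion>\<^bsub>mn_words m n\<^esub> w \<longleftrightarrow> m < w ! s"
proof -
  have len: "length w = n"
    using w by (simp add: mn_word_def)
  have "list_all2 (\<le>) (b_word m n (Suc s)) (map2 max (replicate n 0) w) \<longleftrightarrow> m < w ! s"
    using len s by (auto simp: list_all2_conv_all_nth)
  then show ?thesis
    by (simp only: lower_cover_b_word[OF s] join_mn_words[OF mn_word_zero w] le_mn_words)
qed

section \<open>Unique presentation of the join-irreducible words\<close>

lemma a_word_eq_iff:
  assumes "s \<in> {1..n}" "t \<ge> 1" "s' \<in> {1..n}" "t' \<ge> 1"
  shows "a_word n s t = a_word n s' t' \<longleftrightarrow> s = s' \<and> t = t'"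
proof
  assume eq: "a_word n s t = a_word n s' t'"
  then have *: "(if i < s then t else 0) = (if i < s' then t' else 0)" if "i < n" for i
    using that by (metis nth_a_word)
  \<comment> \<open>Index \<open>s\<close> is the first one past the block of the first word; a
    longer second block would have a nonzero letter there.\<close>
  have "\<not> s < s'" "\<not> s' < s"
    using *[of s] *[of s'] assms by auto
  then show "s = s' \<and> t = t'"
    using *[of 0] assms by auto
qed simp

lemma b_word_eq_iff:
  assumes "s \<in> {1..n}"
  shows "b_word m n s = b_word m n s' \<longleftrightarrow> s = s'"
proof
  assume "b_word m n s = b_word m n s'"
  then have "b_word m n s ! (s - 1) = b_word m n s' ! (s - 1)"
    by simp
  then show "s = s'"
    using assms by (auto split: if_splits)
qed simp

text \<open>The first letters differ: it is \<open>t\<close>, hence nonzero, on the left and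
  \<open>0\<close> on the right because \<open>s'\<close> is at least 2.\<close>

lemma a_word_neq_b_word:
  assumes "s \<in> {1..n}" "t \<in> {1..m}" "s' \<in> {2..n}"
  shows "a_word n s t \<noteq> b_word m n s'"
proof
  assume "a_word n s t = b_word m n s'"
  then have "a_word n s t ! 0 = b_word m n s' ! 0"
    by simp
  then show False
    using assms by auto
qed

section \<open>Comparison of all pairs of join-irreducible words\<close>

theorem theorem5p13:
  fixes m n :: nat
  shows "galois_graph (mn_words m n) =
    \<lparr> pverts = {j. join_irreducible (mn_words m n) j},
      parcs = {(j, j').
        join_irreducible (mn_words m n) j \<and> join_irreducible (mn_words m n) j' \<and> j \<noteq> j' \<and>
        ((\<exists>s t s' t'. s \<in> {1..n} \<and> t \<in> {1..m} \<and> s' \<in> {1..n} \<and> t' \<in> {1..m} \<and>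
            j = a_word n s t \<and> j' = a_word n s' t' \<and> s \<ge> s' \<and> t \<ge> t') \<or>
         (\<exists>s s' t'. s \<in> {2..n} \<and> s' \<in> {1..n} \<and> t' \<in> {1..m} \<and>
            j = b_word m n s \<and> j' = a_word n s' t' \<and> s = s'))} \<rparr>"
proof -
  let ?aa = "\<lambda>j j'. \<exists>s t s' t'. s \<in> {1..n} \<and> t \<in> {1..m} \<and> s' \<in> {1..n} \<and> t' \<in> {1..m} \<and>
            j = a_word n s t \<and> j' = a_word n s' t' \<and> s \<ge> s' \<and> t \<ge> t'"
  let ?ba = "\<lambda>j j'. \<exists>s s' t'. s \<in> {2..n} \<and> s' \<in> {1..n} \<and> t' \<in> {1..m} \<and>
            j = b_word m n s \<and> j' = a_word n s' t' \<and> s = s'"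
  have arrow: "j' \<sqsubseteq>\<^bsub>mn_words m n\<^esub> lower_cover (mn_words m n) j' \<squnion>\<^bsub>mn_words m n\<^esub> j \<longleftrightarrow>
      ?aa j j' \<or> ?ba j j'"
    if j: "join_irreducible (mn_words m n) j" and j': "join_irreducible (mn_words m n) j'"
      and "j \<noteq> j'" for j j'
  proof -
    have word: "mn_word m n j"
      using j by (simp add: join_irreducible_def)
    from j' show ?thesis
    proof (cases rule: join_irreducible_mn_words_cases)
      case a': (a s' t')
      note le_iff = a_word_le_join_iff[OF word a'(1,2), folded a'(3)]
      from j show ?thesis
      proof (cases rule: join_irreducible_mn_words_cases)
        case (a s t)
        \<comment> \<open>The letter of \<open>j\<close> at index \<open>s'\<close> is
          \<open>Suc t\<close> inside the block and \<open>0\<close> outside it.\<close>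
        have "t' < j ! s' \<longleftrightarrow> s' \<le> s \<and> t' \<le> t"
          using a a' by auto
        moreover have "?aa j j' \<longleftrightarrow> s' \<le> s \<and> t' \<le> t"
        proof
          assume "?aa j j'"
          then obtain u v u' v' where *: "u \<in> {1..n}" "v \<in> {1..m}" "u' \<in> {1..n}" "v' \<in> {1..m}"
              "j = a_word n u v" "j' = a_word n u' v'" "u' \<le> u" "v' \<le> v"
            by blast
          then have "u = Suc s" "v = Suc t" "u' = Suc s'" "v' = Suc t'"
            using a a' a_word_eq_iff[of u n v "Suc s" "Suc t"] a_word_eq_iff[of u' n v' "Suc s'" "Suc t'"]
            by simp_all
          with * show "s' \<le> s \<and> t' \<le> t"
            by simp
        next
          assume "s' \<le> s \<and> t' \<le> t"
          with a a' show "?aa j j'"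
            by (intro exI[of _ "Suc s"] exI[of _ "Suc t"] exI[of _ "Suc s'"] exI[of _ "Suc t'"]) simp
        qed
        moreover have "\<not> ?ba j j'"
        proof -
          have "Suc s \<in> {1..n}" "Suc t \<in> {1..m}"
            using a by simp_all
          then show ?thesis
            unfolding a(3) using a_word_neq_b_word by metis
        qed
        ultimately show ?thesis
          by (simp only: le_iff simp_thms)
      next
        case (b s)
        \<comment> \<open>The letter is \<open>m + 1\<close> at index \<open>s\<close>, which
          exceeds \<open>t'\<close>, and \<open>0\<close> at all other indices.\<close>
        have "t' < j ! s' \<longleftrightarrow> s = s'"
          using b a' by auto
        moreover have "?ba j j' \<longleftrightarrow> s = s'"
        proof
          assume "?ba j j'"
          then obtain u u' v' where *: "u \<in> {2..n}" "u' \<in> {1..n}" "v' \<in> {1..m}"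
              "j = b_word m n u" "j' = a_word n u' v'" "u = u'"
            by blast
          then have "u = Suc s" "u' = Suc s'"
            using b a' b_word_eq_iff[of u n m "Suc s"] a_word_eq_iff[of u' n v' "Suc s'" "Suc t'"]
            by simp_all
          with * show "s = s'"
            by simp
        next
          assume "s = s'"
          with b a' show "?ba j j'"
            by (intro exI[of _ "Suc s"] exI[of _ "Suc s'"] exI[of _ "Suc t'"]) simp
        qed
        moreover have "\<not> ?aa j j'"
        proof -
          have "Suc s \<in> {2..n}"
            using b by simp
          then show ?thesis
            unfolding b(3) using a_word_neq_b_word by metis
        qed
        ultimately show ?thesis
          by (simp only: le_iff simp_thms)
      qed
    next
      case b': (b s')
      \<comment> \<open>Letters of an \<open>a_word\<close> are at most \<open>m\<close> here, and a
        \<open>b_word\<close> with \<open>m + 1\<close> at index \<open>s'\<close> would be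
        \<open>j'\<close> itself, contrary to distinctness. So no arrow ends in a
        \<open>b_word\<close>.\<close>
      have "j ! s' \<le> m"
        using j
      proof (cases rule: join_irreducible_mn_words_cases)
        case (a s t)
        then show ?thesis
          using b' by simp
      next
        case (b s)
        then show ?thesis
          using b' \<open>j \<noteq> j'\<close> by auto
      qed
      moreover have "Suc s' \<in> {2..n}"
        using b' by simp
      then have "\<not> ?aa j j'" "\<not> ?ba j j'"
        unfolding b'(3) using a_word_neq_b_word by metis+
      ultimately show ?thesis
        using b_word_le_join_iff[OF word b'(1,2), folded b'(3)] by (simp only: not_le simp_thms)
    qed
  qed
  show ?thesis
    \<comment> \<open>The congruence rule supplies irreducibility and distinctness, under which
      \<open>arrow\<close> may rewrite the last conjunct.\<close>
    by (simp only: galois_graph_def case_prod_unfold arrow simp_thms cong: conj_cong)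
qed

end
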